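(* Let $m,n\ge 1$ be integers and let $\mathcal S=\{s_1,\dots,s_M\}\subset\mathbb C$ be a finite set of $M$ distinct symbols that is symmetric with respect to the origin (i.e. $-\mathcal S=\mathcal S$) and satisfies $0\notin\mathcal S$. Let $x^*\in\mathcal S^n$, $\mathbf H\in\mathbb C^{m\times n}$ and $v\in\mathbb C^m$ be random and put $r=\mathbf Hx^*+v$. Assume that (a) the entries of $x^*$ are drawn from $\mathcal S$ uniformly and independently; (b) $x^*$, $\mathbf H$ and $v$ are mutually independent; and (c) the distributions of $\mathbf H$ and $v$ are continuous (i.e. absolutely continuous with respect to Lebesgue measure on $\mathbb C^{m\times n}$ and $\mathbb C^m$, respectively). Then the relaxation (ESDR1-T) built from $\mathbf H$, $r$ and the symbols $s_1,\dots,s_M$ satisfies $$\mathbf{Prob}\big(\text{(ESDR1-T) is tight}\big)\le\left(\frac12\right)^n .$$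
   Context: Notation: $(\cdot)^\dagger$ is the conjugate transpose, $(\cdot)^{\mathsf T}$ the transpose; $\mathrm{Re},\mathrm{Im}$ act entrywise; $\mathrm{diag}(\mathbf A)$ is the vector of diagonal entries of $\mathbf A$; $\otimes$ is the Kronecker product; $\mathbf A\succeq\mathbf B$ means that $\mathbf A-\mathbf B$ is positive semidefinite; $\langle \mathbf A,\mathbf B\rangle=\mathrm{Re}(\mathrm{Tr}(\mathbf A^\dagger\mathbf B))$. Let $s=(s_1,\dots,s_M)^{\mathsf T}\in\mathbb C^M$, $s_R=\mathrm{Re}(s)$, $s_I=\mathrm{Im}(s)$, $\mathbf Q=\mathbf H^\dagger\mathbf H$, $c=-\mathbf H^\dagger r$, and $$\hat{\mathbf S}=\begin{bmatrix}\mathbf I_n\otimes s_R^{\mathsf T}\\ \mathbf I_n\otimes s_I^{\mathsf T}\end{bmatrix}\in\mathbb R^{2n\times Mn},\quad \hat{\mathbf Q}=\begin{bmatrix}\mathrm{Re}(\mathbf Q)&-\mathrm{Im}(\mathbf Q)\\ \mathrm{Im}(\mathbf Q)&\mathrm{Re}(\mathbf Q)\end{bmatrix},\quad \hat c=\begin{bmatrix}\mathrm{Re}(c)\\ \mathrm{Im}(c)\end{bmatrix},\quad \bar{\mathbf Q}=\hat{\mathbf S}^{\mathsf T}\hat{\mathbf Q}\hat{\mathbf S},\quad \bar c=\hat{\mathbf S}^{\mathsf T}\hat c .$$ (ESDR1-T) is the semidefinite program in the variables $t=[t_1^{\mathsf T},\dots,t_n^{\mathsf T}]^{\mathsf T}\in\mathbb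 R^{Mn}$ with blocks $t_i=(t_{i,1},\dots,t_{i,M})^{\mathsf T}\in\mathbb R^M$, and symmetric $\mathbf T\in\mathbb R^{Mn\times Mn}$, partitioned into $n\times n$ blocks $\mathbf T_{i,j}\in\mathbb R^{M\times M}$: minimize $\langle\bar{\mathbf Q},\mathbf T\rangle+2\bar c^{\mathsf T}t$ subject to $t_{i,j}\ge 0$ and $\sum_{j=1}^M t_{i,j}=1$ for all $i,j$; $\mathrm{diag}(\mathbf T_{i,i})=t_i$ for $i=1,\dots,n$; $\mathbf T\succeq tt^{\mathsf T}$. Write $x_i^*=s_{u_i}$ with $u_i\in\{1,\dots,M\}$, and define $t^*\in\mathbb R^{Mn}$ by $t^*_{i,u_i}=1$ and $t^*_{i,j}=0$ for $j\ne u_i$. (ESDR1-T) is called tight if $(t,\mathbf T)=(t^*,t^*(t^* )^{\mathsf T})$ is an optimal solution of it; uniqueness of the optimal solution is not required. *)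

theory Defs
  imports "HOL-Probability.Probability"
begin

definition conj_transpose :: "complex^'n^'m \<Rightarrow> complex^'m^'n" where
  "conj_transpose A = map_matrix cnj (transpose A)"

definition kronecker :: "real^'b^'a \<Rightarrow> real^'d^'c \<Rightarrow> real^('b \<times> 'd)^('a \<times> 'c)" where
  "kronecker A B = (\<chi> p q. A $ fst p $ fst q * B $ snd p $ snd q)"

text \<open>The inner product \<open>Re (Tr (A\<^sup>\<dagger> B))\<close>, for real matrices.\<close>

definition mat_inner :: "real^'n^'m \<Rightarrow> real^'n^'m \<Rightarrow> real" where
  "mat_inner A B = trace (transpose A ** B)"

definition psd :: "real^'n^'n \<Rightarrow> bool" where
  "psd A \<longleftrightarrow> transpose A = A \<and> (\<forall>x. 0 \<le> x \<bullet> (A *v x))"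

definition loewner_ge :: "real^'n^'n \<Rightarrow> real^'n^'n \<Rightarrow> bool"  (infix \<open>\<succeq>\<close> 50) where
  "A \<succeq> B \<longleftrightarrow> psd (A - B)"

definition outer :: "real^'n \<Rightarrow> real^'n^'n" where
  "outer t = (\<chi> i j. t $ i * t $ j)"

text \<open>
  The type \<open>'n + 'n\<close> indexes two stacked blocks of size \<open>n\<close>, and \<open>'n \<times> 'k\<close> indexes vectors made of
  \<open>n\<close> blocks of size \<open>M = CARD('k)\<close>: \<open>t $ (i, j)\<close> is \<open>t\<^sub>i\<^sub>,\<^sub>j\<close>, and \<open>T $ (i, a) $ (j, b)\<close> is the
  \<open>(a, b)\<close> entry of the block \<open>T\<^sub>i\<^sub>,\<^sub>j\<close>. A row vector is a matrix whose row index type is \<open>1\<close>, so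
  the Kronecker product of the identity with it has rows indexed by \<open>'n \<times> 1\<close>.
\<close>

definition S_hat :: "complex^'k \<Rightarrow> real^('n::finite \<times> 'k)^('n + 'n)" where
  "S_hat s = (\<chi> p. case p of
      Inl i \<Rightarrow> kronecker (mat 1 :: real^'n^'n) (rowvector (\<chi> k. Re (s $ k)) :: real^'k^1) $ (i, 1)
    | Inr i \<Rightarrow> kronecker (mat 1 :: real^'n^'n) (rowvector (\<chi> k. Im (s $ k)) :: real^'k^1) $ (i, 1))"

definition Q_hat :: "complex^'n^'m \<Rightarrow> real^('n + 'n)^('n + 'n)" where
  "Q_hat H = (let Q = conj_transpose H ** H in \<chi> p q. case p of
      Inl i \<Rightarrow> (case q of Inl j \<Rightarrow> Re (Q $ i $ j) | Inr j \<Rightarrow> - Im (Q $ i $ j))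
    | Inr i \<Rightarrow> (case q of Inl j \<Rightarrow> Im (Q $ i $ j) | Inr j \<Rightarrow> Re (Q $ i $ j)))"

definition c_hat :: "complex^'n^'m \<Rightarrow> complex^'m \<Rightarrow> real^('n + 'n)" where
  "c_hat H r = (let c = - (conj_transpose H *v r) in
      \<chi> p. case p of Inl i \<Rightarrow> Re (c $ i) | Inr i \<Rightarrow> Im (c $ i))"

definition Q_bar :: "complex^'k \<Rightarrow> complex^'n^'m \<Rightarrow> real^('n \<times> 'k)^('n \<times> 'k)" where
  "Q_bar s H = transpose (S_hat s) ** Q_hat H ** S_hat s"

definition c_bar :: "complex^'k \<Rightarrow> complex^'n^'m \<Rightarrow> complex^'m \<Rightarrow> real^('n \<times> 'k)" where
  "c_bar s H r = transpose (S_hat s) *v c_hat H r"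

definition esdr1t_objective ::
  "complex^'k \<Rightarrow> complex^'n^'m \<Rightarrow> complex^'m \<Rightarrow> real^('n \<times> 'k) \<Rightarrow> real^('n \<times> 'k)^('n \<times> 'k) \<Rightarrow> real" where
  "esdr1t_objective s H r t T = mat_inner (Q_bar s H) T + 2 * (c_bar s H r \<bullet> t)"

definition esdr1t_feasible :: "real^('n::finite \<times> 'k::finite) \<Rightarrow> real^('n \<times> 'k)^('n \<times> 'k) \<Rightarrow> bool" where
  "esdr1t_feasible t T \<longleftrightarrow>
     transpose T = T \<and>
     (\<forall>i j. 0 \<le> t $ (i, j)) \<and>
     (\<forall>i. (\<Sum>j\<in>UNIV. t $ (i, j)) = 1) \<and>
     (\<forall>i j. T $ (i, j) $ (i, j) = t $ (i, j)) \<and>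
     T \<succeq> outer t"

definition esdr1t_optimal ::
  "complex^'k \<Rightarrow> complex^'n^'m \<Rightarrow> complex^'m \<Rightarrow> real^('n \<times> 'k) \<Rightarrow> real^('n \<times> 'k)^('n \<times> 'k) \<Rightarrow> bool" where
  "esdr1t_optimal s H r t T \<longleftrightarrow>
     esdr1t_feasible t T \<and>
     (\<forall>t' T'. esdr1t_feasible t' T' \<longrightarrow> esdr1t_objective s H r t T \<le> esdr1t_objective s H r t' T')"

text \<open>The index \<open>u\<^sub>i\<close> with \<open>x\<^sub>i = s\<^bsub>u\<^sub>i\<^esub>\<close>; meaningful when \<open>x\<^sub>i\<close> is one of the pairwise distinct symbols.\<close>

definition symbol_index :: "complex^'k \<Rightarrow> complex^'n \<Rightarrow> 'n \<Rightarrow> 'k" where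
  "symbol_index s x i = (THE u. x $ i = s $ u)"

definition t_star :: "complex^'k \<Rightarrow> complex^'n \<Rightarrow> real^('n \<times> 'k)" where
  "t_star s x = (\<chi> p. if snd p = symbol_index s x (fst p) then 1 else 0)"

definition esdr1t_tight :: "complex^'k \<Rightarrow> complex^'n^'m \<Rightarrow> complex^'m \<Rightarrow> complex^'n \<Rightarrow> bool" where
  "esdr1t_tight s H r x \<longleftrightarrow> esdr1t_optimal s H r (t_star s x) (outer (t_star s x))"

text \<open>
  Mutual independence of three random variables with different codomains. The library's
  \<open>indep_vars\<close> needs a common codomain type; this is its definition, with the three generated
  families of events written out.
\<close>

definition preimage_events :: "'w measure \<Rightarrow> 'a measure \<Rightarrow> ('w \<Rightarrow> 'a) \<Rightarrow> 'w set set" where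
  "preimage_events P N X = {X -` A \<inter> space P | A. A \<in> sets N}"

definition indep_vars3 :: "'w measure \<Rightarrow> 'a measure \<Rightarrow> ('w \<Rightarrow> 'a) \<Rightarrow> 'b measure \<Rightarrow> ('w \<Rightarrow> 'b)
    \<Rightarrow> 'c measure \<Rightarrow> ('w \<Rightarrow> 'c) \<Rightarrow> bool" where
  "indep_vars3 P N1 X N2 Y N3 Z \<longleftrightarrow>
     X \<in> measurable P N1 \<and> Y \<in> measurable P N2 \<and> Z \<in> measurable P N3 \<and>
     prob_space.indep_sets P
       (\<lambda>k. [preimage_events P N1 X, preimage_events P N2 Y, preimage_events P N3 Z] ! k) {..<3::nat}"

end

(*
  The symbol -x_i is again available, and in the relaxation t_i may be moved from the vertex of x_i
  towards the vertex of -x_i with a T that realizes, in the original variable, the exact quadratic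
  |H y - r|^2 - |r|^2 where y is x with its i-th coordinate replaced by (1 - 2 e) x_i. Hence tightness forces the derivative
  of the least-squares objective along each of these segments to be nonnegative, that is
  Re (cnj x_i * (H^* v)_i) >= 0 for all i. Almost surely none of these numbers vanishes (for v /= 0
  this is a hyperplane in H), and (H, v) is independent of the x_i, whose signs are symmetric, so
  the n conditions hold with probability exactly (1/2)^n.
*)
theory Submission
  imports Defs
begin

section \<open>Real coordinates for the complex data\<close>

definition stack :: "complex^'n \<Rightarrow> real^('n + 'n)" where
  "stack z = (\<chi> p. case p of Inl i \<Rightarrow> Re (z $ i) | Inr i \<Rightarrow> Im (z $ i))"

lemma sum_UNIV_Plus:
  "(\<Sum>p\<in>(UNIV :: ('a::finite + 'b::finite) set). f p) = (\<Sum>i\<in>UNIV. f (Inl i)) + (\<Sum>i\<in>UNIV. f (Inr i))"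
  unfolding UNIV_Plus_UNIV [symmetric] by (subst sum.Plus) auto

lemma sum_UNIV_Times:
  "(\<Sum>p\<in>(UNIV :: ('a::finite \<times> 'b::finite) set). f p) = (\<Sum>i\<in>UNIV. \<Sum>j\<in>UNIV. f (i, j))"
  unfolding UNIV_Times_UNIV [symmetric] by (simp add: sum.cartesian_product)

lemma stack_linear:
  "stack (z + w) = stack z + stack w" "stack (a *\<^sub>R z) = a *\<^sub>R stack z" "stack (- z) = - stack z"
  by (auto simp: stack_def vec_eq_iff split: sum.split)

lemma inner_stack: "stack z \<bullet> stack w = (\<Sum>i\<in>UNIV. Re (cnj (z $ i) * w $ i))"
  by (simp add: stack_def inner_vec_def sum_UNIV_Plus sum.distrib)

text \<open>The block pattern of \<open>Q_hat\<close> is that of a complex matrix acting on stacked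
  real and imaginary parts, so quadratic expressions can be evaluated on complex vectors.\<close>

lemma Q_hat_stack: "Q_hat H *v stack z = stack ((conj_transpose H ** H) *v z)"
  by (auto simp: Q_hat_def Let_def stack_def vec_eq_iff matrix_vector_mult_def sum_UNIV_Plus
      sum.distrib sum_subtractf sum_negf split: sum.split)

lemma conj_transpose_nth: "(conj_transpose A *v w) $ i = (\<Sum>k\<in>UNIV. cnj (A $ k $ i) * w $ k)"
  by (simp add: conj_transpose_def transpose_def matrix_vector_mult_def)

text \<open>The Gram matrix is Hermitian: its real part is symmetric and its imaginary part
  antisymmetric, and the signs of the off-diagonal blocks of \<open>Q_hat\<close> turn this into
  symmetry.\<close>

lemma transpose_Q_hat: "transpose (Q_hat H) = Q_hat H"
proof -
  have *: "(conj_transpose H ** H) $ i $ j = cnj ((conj_transpose H ** H) $ j $ i)" for i j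
    by (simp add: conj_transpose_def transpose_def matrix_matrix_mult_def mult.commute)
  show ?thesis
    by (auto simp: Q_hat_def Let_def transpose_def vec_eq_iff split: sum.split) (subst *, simp)+
qed

lemma c_hat_eq: "c_hat H r = - stack (conj_transpose H *v r)"
  by (auto simp: c_hat_def Let_def stack_def vec_eq_iff split: sum.split)

text \<open>Reads \<open>S_hat\<close> as the decoding map from block weights to complex vectors,
  which links the lifted program to the original variable.\<close>

lemma S_hat_mult: "S_hat s *v t = stack (\<chi> i. \<Sum>k\<in>UNIV. t $ (i, k) *\<^sub>R s $ k)"
  by (auto simp: S_hat_def stack_def vec_eq_iff matrix_vector_mult_def kronecker_def rowvector_def
      mat_def sum_UNIV_Times if_distrib if_distribR cong: if_cong split: sum.split;
      subst sum.swap; simp add: mult.commute)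

section \<open>The objective on rank-one terms\<close>

lemma mat_inner_outer: "mat_inner A (outer w) = w \<bullet> (A *v w)"
proof -
  have "mat_inner A (outer w) = (\<Sum>i\<in>UNIV. \<Sum>j\<in>UNIV. A $ j $ i * (w $ j * w $ i))"
    by (simp add: mat_inner_def outer_def trace_def matrix_matrix_mult_def transpose_def)
  also have "\<dots> = w \<bullet> (A *v w)"
    by (subst sum.swap)
       (simp add: inner_vec_def matrix_vector_mult_def sum_distrib_left algebra_simps)
  finally show ?thesis .
qed

lemma mat_inner_linear:
  "mat_inner A (B + C) = mat_inner A B + mat_inner A C"
  "mat_inner A (a *\<^sub>R B) = a * mat_inner A B"
  by (simp_all add: mat_inner_def trace_def matrix_matrix_mult_def transpose_def algebra_simps
      sum.distrib sum_distrib_left)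

lemma inner_Q_bar: "w \<bullet> (Q_bar s H *v w) = (S_hat s *v w) \<bullet> (Q_hat H *v (S_hat s *v w))"
proof -
  have "Q_bar s H *v w = (Q_hat H *v (S_hat s *v w)) v* S_hat s"
    by (simp add: Q_bar_def matrix_vector_mul_assoc [symmetric])
  then show ?thesis
    by (simp add: inner_commute [of w] dot_lmul_matrix) (simp add: inner_commute)
qed

text \<open>\<open>Q_bar\<close> sees a rank-one term only through the image of its vector under
  \<open>S_hat\<close>. A slack along the kernel of \<open>S_hat\<close> is therefore free, and what
  remains is the quadratic in the decoded vector.\<close>

lemma objective_outer:
  assumes "S_hat s *v w = 0"
  shows "esdr1t_objective s H r t (outer t + a *\<^sub>R outer w) =
    (S_hat s *v t) \<bullet> (Q_hat H *v (S_hat s *v t)) + 2 * (c_hat H r \<bullet> (S_hat s *v t))"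
  using assms
  by (simp add: esdr1t_objective_def mat_inner_linear mat_inner_outer inner_Q_bar c_bar_def
      dot_lmul_matrix)

section \<open>Feasible moves and the first-order condition\<close>

lemma psd_outer: "0 \<le> a \<Longrightarrow> psd (a *\<^sub>R outer w)"
proof -
  assume a: "0 \<le> a"
  have "outer w *v x = (w \<bullet> x) *\<^sub>R w" for x
    by (simp add: outer_def vec_eq_iff matrix_vector_mult_def inner_vec_def sum_distrib_left
        algebra_simps)
  then have "x \<bullet> ((a *\<^sub>R outer w) *v x) = a * (w \<bullet> x)\<^sup>2" for x
    by (simp add: scaleR_matrix_vector_assoc [symmetric] power2_eq_square inner_commute)
  with a show ?thesis
    by (simp add: psd_def transpose_def outer_def vec_eq_iff mult.commute)
qed

text \<open>Explicit form of \<open>t_star\<close> for a known selection \<open>u\<close>, without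
  the definite description in \<open>symbol_index\<close>.\<close>

definition vertex :: "('n \<Rightarrow> 'k) \<Rightarrow> real^('n::finite \<times> 'k::finite)" where
  "vertex u = (\<chi> p. if snd p = u (fst p) then 1 else 0)"

lemma t_star_vertex:
  assumes "inj (\<lambda>k. s $ k)" "\<And>i. x $ i = s $ u i"
  shows "t_star s x = vertex u"
proof -
  have "symbol_index s x i = u i" for i
    unfolding symbol_index_def using assms by (auto simp: inj_def)
  then show ?thesis by (simp add: t_star_def vertex_def)
qed

lemma S_hat_vertex: "S_hat s *v vertex u = stack (\<chi> i. s $ u i)"
  by (simp add: S_hat_mult vertex_def if_distrib if_distribR cong: if_cong)

lemma S_hat_axis: "S_hat s *v axis (i, k) 1 = stack (axis i (s $ k))"
proof -
  have "(\<Sum>k'\<in>UNIV. axis (i, k) (1::real) $ (i', k') *\<^sub>R s $ k') = axis i (s $ k) $ i'" for i'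
    by (cases "i' = i") (auto simp: axis_def if_distrib if_distribR cong: if_cong)
  then show ?thesis by (simp add: S_hat_mult vec_eq_iff)
qed

text \<open>Moving \<open>t\<^sub>i\<close> from a symbol towards its negative costs nothing in the lifted
  variable: the slack \<open>T - t t\<^sup>T\<close> is a multiple of \<open>w w\<^sup>T\<close> where \<open>w\<close> has weight one on two symbols
  which cancel.\<close>

lemma feasible_move:
  assumes "0 \<le> e" "e \<le> 1" "k \<noteq> u i"
  shows "esdr1t_feasible (vertex u + e *\<^sub>R (axis (i, k) 1 - axis (i, u i) 1))
    (outer (vertex u + e *\<^sub>R (axis (i, k) 1 - axis (i, u i) 1))
      + (e * (1 - e)) *\<^sub>R outer (axis (i, k) 1 + axis (i, u i) 1))"
  (is "esdr1t_feasible ?t (outer ?t + _ *\<^sub>R outer ?w)")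
  unfolding esdr1t_feasible_def
proof (intro conjI allI)
  show "transpose (outer ?t + (e * (1 - e)) *\<^sub>R outer ?w) = outer ?t + (e * (1 - e)) *\<^sub>R outer ?w"
    by (simp add: transpose_def outer_def vec_eq_iff mult.commute)
  show "0 \<le> ?t $ (i', j)" for i' j
    using assms by (auto simp: vertex_def axis_def)
  show "(\<Sum>j\<in>UNIV. ?t $ (i', j)) = 1" for i'
    by (cases "i' = i")
       (auto simp: vertex_def axis_def sum.distrib sum_subtractf sum_distrib_left [symmetric])
  \<comment> \<open>This condition dictates the coefficient: the moved entries are \<open>e\<close>
    and \<open>1 - e\<close>, and each exceeds its own square by exactly
    \<open>e * (1 - e)\<close>.\<close>
  show "(outer ?t + (e * (1 - e)) *\<^sub>R outer ?w) $ (i', j) $ (i', j) = ?t $ (i', j)" for i' j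
    using assms(3) by (auto simp: vertex_def axis_def outer_def algebra_simps)
  show "outer ?t + (e * (1 - e)) *\<^sub>R outer ?w \<succeq> outer ?t"
    using psd_outer [of "e * (1 - e)" ?w] assms by (simp add: loewner_ge_def)
qed

text \<open>Moving a fraction \<open>e\<close> of the weight from \<open>x $ i\<close> to its
  negative changes the objective by \<open>4 * e * g + 4 * e^2 * q\<close>, with \<open>g\<close>
  the real part in question. If \<open>g\<close> were negative, a small \<open>e\<close> would beat
  the vertex.\<close>

lemma tight_imp_Re_nonneg:
  fixes s :: "complex^'k" and x :: "complex^'n" and H :: "complex^'n^'m" and v :: "complex^'m"
  assumes inj: "inj (\<lambda>k. s $ k)" and u: "\<And>i. x $ i = s $ u i"
    and k: "s $ k = - x $ i" and nz: "x $ i \<noteq> 0"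
    and tight: "esdr1t_tight s H (H *v x + v) x"
  shows "0 \<le> Re (cnj (x $ i) * (conj_transpose H *v v) $ i)"
proof (rule ccontr)
  define g where "g = Re (cnj (x $ i) * (conj_transpose H *v v) $ i)"
  define d where "d = stack (axis i (x $ i))"
  define q where "q = d \<bullet> (Q_hat H *v d)"
  \<comment> \<open>The bound 1 keeps the move feasible. The other bound makes
    \<open>g + e * q\<close> at most \<open>- e\<close>, hence strictly negative; the added 1 also
    keeps the denominator positive when \<open>q\<close> vanishes.\<close>
  define e where "e = min 1 (- g / (\<bar>q\<bar> + 1))"
  let ?r = "H *v x + v"
  assume "\<not> 0 \<le> Re (cnj (x $ i) * (conj_transpose H *v v) $ i)"
  then have g: "g < 0" by (simp add: g_def)
  have e: "0 < e" "e \<le> 1" "e * (\<bar>q\<bar> + 1) \<le> - g"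
  proof -
    show "0 < e" "e \<le> 1"
      using g by (simp_all add: e_def divide_neg_pos)
    have "e * (\<bar>q\<bar> + 1) \<le> - g / (\<bar>q\<bar> + 1) * (\<bar>q\<bar> + 1)"
      by (intro mult_right_mono) (simp_all add: e_def)
    then show "e * (\<bar>q\<bar> + 1) \<le> - g" by simp
  qed
  \<comment> \<open>A nonzero number differs from its negative, so the weight really moves to
    another coordinate.\<close>
  have ku: "k \<noteq> u i"
    using k u [of i] nz by (auto simp: eq_neg_iff_add_eq_0)
  let ?w = "axis (i, k) 1 + axis (i, u i) 1 :: real^('n \<times> 'k)"
  let ?t = "vertex u + e *\<^sub>R (axis (i, k) 1 - axis (i, u i) 1) :: real^('n \<times> 'k)"
  have axis_neg: "axis i (- x $ i) = - axis i (x $ i)"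
    by (simp add: axis_def vec_eq_iff)
  have w: "S_hat s *v ?w = 0"
    using k by (simp add: matrix_vector_right_distrib S_hat_axis u [symmetric] axis_neg stack_linear)
  have xu: "(\<chi> i. s $ u i) = x"
    by (simp add: vec_eq_iff u)
  \<comment> \<open>Losing weight \<open>e\<close> on \<open>x $ i\<close> and gaining it on the
    negative both push the same way, whence the factor 2 below.\<close>
  have "S_hat s *v ?t = stack x + e *\<^sub>R (- d - d)"
    using k by (simp add: matrix_vector_right_distrib matrix_vector_mult_diff_distrib
      matrix_vector_mult_scaleR S_hat_vertex S_hat_axis u [symmetric] axis_neg stack_linear xu d_def)
  then have t: "S_hat s *v ?t = stack x - (2 * e) *\<^sub>R d"
    by (simp add: vec_eq_iff)
  have "esdr1t_objective s H ?r (vertex u) (outer (vertex u)) \<le>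
      esdr1t_objective s H ?r ?t (outer ?t + (e * (1 - e)) *\<^sub>R outer ?w)"
    using tight feasible_move [of e k u i] e ku
    by (simp add: esdr1t_tight_def esdr1t_optimal_def t_star_vertex [OF inj u])
  moreover have "esdr1t_objective s H ?r (vertex u) (outer (vertex u)) =
      stack x \<bullet> (Q_hat H *v stack x) + 2 * (c_hat H ?r \<bullet> stack x)"
    using objective_outer [OF w, of H ?r "vertex u" 0] by (simp add: S_hat_vertex xu)
  moreover have "esdr1t_objective s H ?r ?t (outer ?t + (e * (1 - e)) *\<^sub>R outer ?w) =
      (stack x - (2 * e) *\<^sub>R d) \<bullet> (Q_hat H *v (stack x - (2 * e) *\<^sub>R d))
      + 2 * (c_hat H ?r \<bullet> (stack x - (2 * e) *\<^sub>R d))"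
    using objective_outer [OF w, of H ?r ?t "e * (1 - e)"] by (simp add: t)
  moreover have "stack x \<bullet> (Q_hat H *v d) = d \<bullet> (Q_hat H *v stack x)"
    by (subst dot_lmul_matrix [symmetric], subst transpose_matrix_vector [symmetric])
       (simp add: transpose_Q_hat inner_commute)
  ultimately have *: "0 \<le> - 4 * e * (d \<bullet> (Q_hat H *v stack x) + c_hat H ?r \<bullet> d) + 4 * e\<^sup>2 * q"
    by (simp add: inner_diff_left inner_diff_right matrix_vector_mult_diff_distrib
        matrix_vector_mult_scaleR q_def algebra_simps power2_eq_square)
  have "d \<bullet> (Q_hat H *v stack x) + c_hat H ?r \<bullet> d = - g"
  proof -
    have "d \<bullet> (Q_hat H *v stack x) + c_hat H ?r \<bullet> d = d \<bullet> (Q_hat H *v stack x + c_hat H ?r)"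
      by (simp add: inner_commute inner_add_right)
    \<comment> \<open>Substituting \<open>?r\<close> cancels the signal part of the gradient; only
      the noise term survives.\<close>
    also have "Q_hat H *v stack x + c_hat H ?r = - stack (conj_transpose H *v v)"
      by (simp add: Q_hat_stack c_hat_eq matrix_vector_right_distrib stack_linear
          matrix_vector_mul_assoc)
    also have "d \<bullet> - stack (conj_transpose H *v v) = - g"
    proof -
      have "(\<Sum>j\<in>UNIV. Re (cnj (axis i (x $ i) $ j) * (conj_transpose H *v v) $ j)) =
          (\<Sum>j\<in>UNIV. if j = i then g else 0)"
        by (rule sum.cong) (auto simp: axis_def g_def)
      then show ?thesis
        by (simp add: d_def inner_stack)
    qed
    finally show ?thesis .
  qed
  with * have "0 \<le> - 4 * e * (- g) + 4 * e\<^sup>2 * q"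
    by simp
  then have "0 \<le> 4 * e * (g + e * q)"
    by (simp add: algebra_simps power2_eq_square)
  then have "0 \<le> g + e * q"
    using e(1) by (simp add: zero_le_mult_iff)
  moreover have "e * q \<le> e * \<bar>q\<bar>"
    using e(1) by (simp add: mult_left_mono)
  moreover have "e * \<bar>q\<bar> + e \<le> - g"
    using e(3) by (simp only: distrib_left mult_1_right)
  ultimately show False
    using e(1) by linarith
qed

section \<open>Factorization of joint events under mutual independence\<close>

lemma indep_vars3_prob:
  assumes "prob_space P" "indep_vars3 P N1 X N2 Y N3 Z"
    and "A \<in> sets N1" "B \<in> sets N2" "C \<in> sets N3"
  shows "measure P {\<omega> \<in> space P. X \<omega> \<in> A \<and> Y \<omega> \<in> B \<and> Z \<omega> \<in> C} =
    measure P (X -` A \<inter> space P) * measure P (Y -` B \<inter> space P) * measure P (Z -` C \<inter> space P)"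
proof -
  interpret prob_space P by fact
  let ?F = "\<lambda>k. [preimage_events P N1 X, preimage_events P N2 Y, preimage_events P N3 Z] ! k"
  let ?E = "\<lambda>k. [X -` A \<inter> space P, Y -` B \<inter> space P, Z -` C \<inter> space P] ! k"
  have three: "{..<3::nat} = {0, 1, 2}" by auto
  have "prob (\<Inter>k\<in>{..<3}. ?E k) = (\<Prod>k\<in>{..<3}. prob (?E k))"
  proof (rule indep_setsD)
    show "indep_sets ?F {..<3}" using assms(2) by (simp add: indep_vars3_def)
    show "\<forall>k\<in>{..<3}. ?E k \<in> ?F k"
      using assms(3-5) by (auto simp: three preimage_events_def)
  qed (simp_all add: three)
  moreover have "(\<Inter>k\<in>{..<3}. ?E k) = {\<omega> \<in> space P. X \<omega> \<in> A \<and> Y \<omega> \<in> B \<and> Z \<omega> \<in> C}"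
    by (auto simp: three)
  ultimately show ?thesis by (simp add: three mult.assoc)
qed

text \<open>Conditioning on \<open>X\<close> in \<open>A\<close> divides the triple product by its
  first factor, so the conditional law of the pair has product values on rectangles, and these
  determine a product of sigma-finite measures.\<close>

lemma indep_vars3_distr_uniform_measure:
  assumes P: "prob_space P" and indep: "indep_vars3 P N1 X N2 Y N3 Z"
    and A: "A \<in> sets N1" and pos: "measure P (X -` A \<inter> space P) \<noteq> 0"
  shows "distr (uniform_measure P (X -` A \<inter> space P)) (N2 \<Otimes>\<^sub>M N3) (\<lambda>\<omega>. (Y \<omega>, Z \<omega>)) =
    distr P N2 Y \<Otimes>\<^sub>M distr P N3 Z"
proof (rule pair_measure_eqI [symmetric])
  interpret prob_space P by fact
  have [measurable]: "X \<in> measurable P N1" "Y \<in> measurable P N2" "Z \<in> measurable P N3"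
    using indep by (simp_all add: indep_vars3_def)
  show "sigma_finite_measure (distr P N2 Y)" "sigma_finite_measure (distr P N3 Z)"
    by (auto intro!: prob_space_imp_sigma_finite prob_space_distr)
  show "sets (distr P N2 Y \<Otimes>\<^sub>M distr P N3 Z) =
      sets (distr (uniform_measure P (X -` A \<inter> space P)) (N2 \<Otimes>\<^sub>M N3) (\<lambda>\<omega>. (Y \<omega>, Z \<omega>)))"
    by (simp cong: sets_pair_measure_cong)
  fix B C assume "B \<in> sets (distr P N2 Y)" "C \<in> sets (distr P N3 Z)"
  then have [measurable]: "B \<in> sets N2" "C \<in> sets N3" by simp_all
  let ?E = "X -` A \<inter> space P"
  have E: "?E \<in> sets P" using A by simp
  have "emeasure (distr (uniform_measure P ?E) (N2 \<Otimes>\<^sub>M N3) (\<lambda>\<omega>. (Y \<omega>, Z \<omega>))) (B \<times> C) =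
      emeasure (uniform_measure P ?E) {\<omega> \<in> space P. Y \<omega> \<in> B \<and> Z \<omega> \<in> C}"
    by (subst emeasure_distr) (auto intro!: arg_cong [where f = "emeasure _"])
  also have "\<dots> = emeasure P (?E \<inter> {\<omega> \<in> space P. Y \<omega> \<in> B \<and> Z \<omega> \<in> C}) / emeasure P ?E"
    using E by (intro emeasure_uniform_measure) auto
  also have "?E \<inter> {\<omega> \<in> space P. Y \<omega> \<in> B \<and> Z \<omega> \<in> C} = {\<omega> \<in> space P. X \<omega> \<in> A \<and> Y \<omega> \<in> B \<and> Z \<omega> \<in> C}"
    by auto
  also have "emeasure P \<dots> / emeasure P ?E =
      ennreal (measure P (Y -` B \<inter> space P) * measure P (Z -` C \<inter> space P))"
    using pos indep_vars3_prob [OF P indep A \<open>B \<in> sets N2\<close> \<open>C \<in> sets N3\<close>]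
    by (simp add: emeasure_eq_measure divide_ennreal zero_less_measure_iff)
  also have "\<dots> = emeasure (distr P N2 Y) B * emeasure (distr P N3 Z) C"
    by (simp add: emeasure_distr emeasure_eq_measure ennreal_mult)
  finally show "emeasure (distr P N2 Y) B * emeasure (distr P N3 Z) C =
      emeasure (distr (uniform_measure P ?E) (N2 \<Otimes>\<^sub>M N3) (\<lambda>\<omega>. (Y \<omega>, Z \<omega>))) (B \<times> C)" ..
qed

text \<open>Tightness is not a rectangle in the channel and the noise, so the product rule is needed
  for arbitrary \<open>D\<close>. It follows from the conditional law of the pair; if
  \<open>X\<close> lies in \<open>A\<close> with probability zero, both sides vanish.\<close>

lemma indep_vars3_prob_pair:
  assumes P: "prob_space P" and indep: "indep_vars3 P N1 X N2 Y N3 Z"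
    and A: "A \<in> sets N1" and D: "D \<in> sets (N2 \<Otimes>\<^sub>M N3)"
  shows "measure P {\<omega> \<in> space P. X \<omega> \<in> A \<and> (Y \<omega>, Z \<omega>) \<in> D} =
    measure P (X -` A \<inter> space P) * measure (distr P N2 Y \<Otimes>\<^sub>M distr P N3 Z) D"
proof (cases "measure P (X -` A \<inter> space P) = 0")
  interpret prob_space P by fact
  have [measurable]: "X \<in> measurable P N1" "Y \<in> measurable P N2" "Z \<in> measurable P N3"
    using indep by (simp_all add: indep_vars3_def)
  let ?E = "X -` A \<inter> space P"
  have E: "?E \<in> sets P" using A by simp
  {
    case True
    have "measure P {\<omega> \<in> space P. X \<omega> \<in> A \<and> (Y \<omega>, Z \<omega>) \<in> D} \<le> measure P ?E"
      using E by (intro finite_measure_mono) auto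
    with True show ?thesis by (simp add: measure_le_0_iff)
  next
    case False
    have YZ: "(\<lambda>\<omega>. (Y \<omega>, Z \<omega>)) -` D \<inter> space P \<in> sets P"
      using D by measurable
    have "measure (distr P N2 Y \<Otimes>\<^sub>M distr P N3 Z) D =
        measure (uniform_measure P ?E) ((\<lambda>\<omega>. (Y \<omega>, Z \<omega>)) -` D \<inter> space P)"
      using D by (subst indep_vars3_distr_uniform_measure [OF P indep A False, symmetric])
        (subst measure_distr, auto)
    also have "\<dots> = measure P (?E \<inter> ((\<lambda>\<omega>. (Y \<omega>, Z \<omega>)) -` D \<inter> space P)) / measure P ?E"
      using False E YZ by (intro measure_uniform_measure) (auto simp: emeasure_eq_measure)
    also have "?E \<inter> ((\<lambda>\<omega>. (Y \<omega>, Z \<omega>)) -` D \<inter> space P) = {\<omega> \<in> space P. X \<omega> \<in> A \<and> (Y \<omega>, Z \<omega>) \<in> D}"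
      by auto
    finally show ?thesis using False by simp
  }
qed

section \<open>Sign counting and almost sure nonvanishing\<close>

lemma card_sign_half:
  fixes s :: "complex^'k" and g :: complex
  assumes inj: "inj (\<lambda>k. s $ k)" and sym: "uminus ` range (\<lambda>k. s $ k) = range (\<lambda>k. s $ k)"
    and nz: "\<And>k. Re (cnj (s $ k) * g) \<noteq> 0"
  shows "2 * card {k. 0 \<le> Re (cnj (s $ k) * g)} = CARD('k)"
proof -
  have "\<exists>k'. s $ k' = - s $ k" for k
    using sym by (metis imageE image_eqI rangeI)
  then obtain n where n: "\<And>k. s $ n k = - s $ k" by metis
  have nn: "n (n k) = k" for k
    using inj n by (metis injD minus_minus)
  let ?A = "{k. 0 \<le> Re (cnj (s $ k) * g)}"
  \<comment> \<open>Negation, as the index involution \<open>n\<close>, exchanges the two sign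
    classes. A value zero would be nonnegative for both a symbol and its negative; \<open>nz\<close>
    excludes it.\<close>
  have flip: "0 \<le> Re (cnj (s $ n k) * g) \<longleftrightarrow> \<not> 0 \<le> Re (cnj (s $ k) * g)" for k
    using nz [of k] n [of k] by (auto simp: algebra_simps)
  have "bij_betw n ?A (- ?A)"
    using flip nn by (intro bij_betw_byWitness [where f' = n]) auto
  then have "card ?A = card (- ?A)" by (rule bij_betw_same_card)
  moreover have "card ?A + card (- ?A) = CARD('k)"
    by (subst card_Un_disjoint [symmetric]) auto
  ultimately show ?thesis by simp
qed

text \<open>Negligibility refers to the completed measure. A hyperplane is closed, hence Borel, so
  it is also null for \<open>lborel\<close>, to which absolute continuity refers.\<close>

lemma null_sets_hyperplane:
  fixes a :: "'a::euclidean_space"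
  assumes "a \<noteq> 0"
  shows "{x. a \<bullet> x = 0} \<in> null_sets lborel"
proof -
  have "negligible {x. a \<bullet> x = 0}"
    using assms by (intro negligible_hyperplane) auto
  moreover have "{x. a \<bullet> x = 0} \<in> sets lborel"
    by (simp add: borel_closed closed_hyperplane)
  ultimately show ?thesis
    by (simp add: negligible_iff_null_sets null_sets_completion_iff)
qed

lemma AE_Re_conj_transpose_nonzero:
  fixes PH :: "(complex^'n^'m) measure" and Pv :: "(complex^'m) measure"
  assumes "prob_space PH" "prob_space Pv"
    and sets: "sets PH = sets borel" "sets Pv = sets borel"
    and ac: "absolutely_continuous lborel PH" "absolutely_continuous lborel Pv"
    and c: "c \<noteq> 0"
  shows "AE p in PH \<Otimes>\<^sub>M Pv. Re (c * (conj_transpose (fst p) *v snd p) $ i) \<noteq> 0"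
proof -
  interpret PH: prob_space PH by fact
  interpret Pv: prob_space Pv by fact
  interpret pair_sigma_finite PH Pv ..
  let ?Q = "\<lambda>(H :: complex^'n^'m) v. Re (c * (conj_transpose H *v v) $ i) \<noteq> 0"
  have "{p. ?Q (fst p) (snd p)} \<in> sets (borel \<Otimes>\<^sub>M borel)"
  proof -
    have "continuous_on UNIV (\<lambda>p :: (complex^'n^'m) \<times> (complex^'m).
        Re (c * (\<Sum>k\<in>UNIV. cnj (fst p $ k $ i) * snd p $ k)))"
      by (intro continuous_intros)
    then have "open {p :: (complex^'n^'m) \<times> (complex^'m). ?Q (fst p) (snd p)}"
      unfolding conj_transpose_def
      by (intro open_Collect_neq continuous_on_const)
         (simp add: transpose_def matrix_vector_mult_def)
    then show ?thesis by (subst borel_prod) (rule borel_open)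
  qed
  then have Q: "{p \<in> space (PH \<Otimes>\<^sub>M Pv). ?Q (fst p) (snd p)} \<in> sets (PH \<Otimes>\<^sub>M Pv)"
    using sets by (simp add: space_pair_measure sets_eq_imp_space_eq [OF sets(1)]
      sets_eq_imp_space_eq [OF sets(2)] cong: sets_pair_measure_cong)
  have "{0} \<in> null_sets (lborel :: (complex^'m) measure)"
    by (simp add: null_sets_def)
  then have "{0} \<in> null_sets Pv"
    using ac(2) by (auto simp: absolutely_continuous_def)
  then have "AE v in Pv. v \<noteq> 0"
    by (rule AE_I') auto
  then have "AE v in Pv. AE H in PH. ?Q H v"
  proof eventually_elim
    case (elim v)
    \<comment> \<open>Coefficients of the functional in \<open>H\<close> for fixed \<open>v\<close>,
      supported in column \<open>i\<close>. The real inner product on the complex numbers conjugates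
      one factor, which accounts for the conjugate on \<open>H\<close>.\<close>
    define a :: "complex^'n^'m" where "a = (\<chi> k l. if l = i then c * v $ k else 0)"
    obtain k where "v $ k \<noteq> 0" using elim by (auto simp: vec_eq_iff)
    then have "a $ k $ i \<noteq> 0" using c by (simp add: a_def)
    then have "a \<noteq> 0" by auto
    have "a \<bullet> H = Re (c * (conj_transpose H *v v) $ i)" for H
    proof -
      have "a \<bullet> H = (\<Sum>k\<in>UNIV. \<Sum>l\<in>UNIV. if l = i then (c * v $ k) \<bullet> H $ k $ i else 0)"
        unfolding inner_vec_def a_def by (intro sum.cong) auto
      also have "\<dots> = Re (c * (conj_transpose H *v v) $ i)"
        by (simp add: conj_transpose_def transpose_def matrix_vector_mult_def inner_complex_def
            sum_distrib_left algebra_simps)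
      finally show ?thesis .
    qed
    then have "{H. \<not> ?Q H v} \<in> null_sets lborel"
      using null_sets_hyperplane [OF \<open>a \<noteq> 0\<close>] by simp
    then have "{H. \<not> ?Q H v} \<in> null_sets PH"
      using ac(1) by (auto simp: absolutely_continuous_def)
    then show ?case by (rule AE_I') auto
  qed
  \<comment> \<open>Fixing \<open>v\<close> first put \<open>H\<close> innermost; the product
    measure is built with \<open>H\<close> outermost.\<close>
  then have "AE H in PH. AE v in Pv. ?Q H v"
    by (subst AE_commute [OF Q])
  with Q show ?thesis by (intro AE_pair_measure) auto
qed

section \<open>Closedness, and hence measurability, of the events\<close>

lemma continuous_on_objective:
  fixes H :: "'a::topological_space \<Rightarrow> complex^'n^'m" and r :: "'a \<Rightarrow> complex^'m"
  assumes H: "continuous_on A H" and r: "continuous_on A r"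
  shows "continuous_on A (\<lambda>p. esdr1t_objective s (H p) (r p) t T)"
proof -
  have Q: "continuous_on A (\<lambda>p. Q_hat (H p) $ a $ b)" for a b
    by (cases a; cases b)
       (auto simp: Q_hat_def Let_def conj_transpose_def transpose_def matrix_matrix_mult_def
         intro!: continuous_intros H)
  have c: "continuous_on A (\<lambda>p. c_hat (H p) (r p) $ a)" for a
    by (cases a)
       (auto simp: c_hat_def Let_def conj_transpose_def transpose_def matrix_vector_mult_def
         intro!: continuous_intros H r)
  have "continuous_on A (\<lambda>p. \<chi> a b. Q_hat (H p) $ a $ b)"
      "continuous_on A (\<lambda>p. \<chi> a. c_hat (H p) (r p) $ a)"
    by (intro continuous_on_vec_lambda Q c)+
  then have "continuous_on A (\<lambda>p. Q_hat (H p))" "continuous_on A (\<lambda>p. c_hat (H p) (r p))"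
    by simp_all
  then show ?thesis
    by (auto simp: esdr1t_objective_def mat_inner_def Q_bar_def c_bar_def trace_def inner_vec_def
        transpose_def matrix_vector_mult_def matrix_matrix_mult_def intro!: continuous_intros)
qed

text \<open>For fixed \<open>x\<close> the feasible set does not depend on channel or noise, so
  optimality is an intersection of closed conditions, one per competitor. The intersection is
  uncountable but still closed, hence Borel.\<close>

lemma closed_tight:
  fixes x :: "complex^'n"
  shows "closed {p :: (complex^'n^'m) \<times> (complex^'m). esdr1t_tight s (fst p) (fst p *v x + snd p) x}"
proof -
  have "continuous_on UNIV (\<lambda>p :: (complex^'n^'m) \<times> (complex^'m). fst p *v x + snd p)"
    unfolding matrix_vector_mult_def by (intro continuous_intros)
  then have "continuous_on UNIV (\<lambda>p :: (complex^'n^'m) \<times> (complex^'m).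
      esdr1t_objective s (fst p) (fst p *v x + snd p) t T)" for t T
    by (intro continuous_on_objective) (auto intro: continuous_intros)
  then show ?thesis
    unfolding esdr1t_tight_def esdr1t_optimal_def
    by (intro closed_Collect_conj closed_Collect_const closed_Collect_all closed_Collect_imp
        open_Collect_const closed_Collect_le)
qed

lemma closed_Re_nonneg:
  "closed {p :: (complex^'n^'m) \<times> (complex^'m).
    \<forall>i. 0 \<le> Re (cnj (x $ i) * (conj_transpose (fst p) *v snd p) $ i)}"
  unfolding conj_transpose_nth
  by (intro closed_Collect_all closed_Collect_le continuous_intros)

section \<open>The probability bound by averaging over symbol selections\<close>

theorem corollary3p8:
  fixes P :: "'w measure"
    and s :: "complex^'k" and S :: "complex set"
    and x :: "'w \<Rightarrow> complex^'n"
    and H :: "'w \<Rightarrow> complex^'n^'m"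
    and v r :: "'w \<Rightarrow> complex^'m"
  assumes "prob_space P"
    and distinct_symbols: "inj (\<lambda>k. s $ k)"
    and S_eq: "S = range (\<lambda>k. s $ k)"
    and symmetric: "uminus ` S = S"
    and nonzero: "0 \<notin> S"
    and x_in_S: "\<forall>\<omega>\<in>space P. \<forall>i. x \<omega> $ i \<in> S"
    and r_eq: "\<forall>\<omega>\<in>space P. r \<omega> = H \<omega> *v x \<omega> + v \<omega>"
    and x_uniform: "\<forall>i. distr P (count_space S) (\<lambda>\<omega>. x \<omega> $ i) = uniform_count_measure S"
    and x_indep: "prob_space.indep_vars P (\<lambda>i. count_space S) (\<lambda>i \<omega>. x \<omega> $ i) UNIV"
    and mutually_indep: "indep_vars3 P borel x borel H borel v"
    and H_continuous: "absolutely_continuous lborel (distr P borel H)"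
    and v_continuous: "absolutely_continuous lborel (distr P borel v)"
  shows "{\<omega> \<in> space P. esdr1t_tight s (H \<omega>) (r \<omega>) (x \<omega>)} \<in> sets P \<and>
         measure P {\<omega> \<in> space P. esdr1t_tight s (H \<omega>) (r \<omega>) (x \<omega>)} \<le> (1 / 2) ^ CARD('n)"
proof -
  interpret prob_space P by fact
  have [measurable]: "x \<in> measurable P borel" "H \<in> measurable P borel" "v \<in> measurable P borel"
    using mutually_indep by (simp_all add: indep_vars3_def)
  define R where "R = distr P borel H \<Otimes>\<^sub>M distr P borel v"
  interpret H: prob_space "distr P borel H" by (rule prob_space_distr) simp
  interpret v: prob_space "distr P borel v" by (rule prob_space_distr) simp
  interpret HV: pair_prob_space "distr P borel H" "distr P borel v" ..
  interpret R: prob_space R unfolding R_def by (rule HV.P.prob_space_axioms)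
  have sets_R: "sets R = sets (borel \<Otimes>\<^sub>M borel)"
    unfolding R_def by (intro sets_pair_measure_cong sets_distr)
  \<comment> \<open>The \<open>a u\<close> enumerate the possible values of \<open>x\<close>.
    Freezing \<open>x\<close> at \<open>a u\<close> leaves the events \<open>K u\<close> (tightness)
    and \<open>G u\<close> (sign conditions) in channel and noise alone, where independence from
    \<open>x\<close> applies.\<close>
  define a :: "('n \<Rightarrow> 'k) \<Rightarrow> complex^'n" where "a u = (\<chi> i. s $ u i)" for u
  define K where "K u = {p :: (complex^'n^'m) \<times> (complex^'m).
    esdr1t_tight s (fst p) (fst p *v a u + snd p) (a u)}" for u
  define G where "G u = {p :: (complex^'n^'m) \<times> (complex^'m).
    \<forall>i. 0 \<le> Re (cnj (a u $ i) * (conj_transpose (fst p) *v snd p) $ i)}" for u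
  have K_sets: "K u \<in> sets (borel \<Otimes>\<^sub>M borel)" for u
    unfolding K_def borel_prod by (rule borel_closed) (rule closed_tight)
  have G_sets: "G u \<in> sets (borel \<Otimes>\<^sub>M borel)" for u
    unfolding G_def borel_prod by (rule borel_closed) (rule closed_Re_nonneg)
  have s_nz: "s $ k \<noteq> 0" for k
    using nonzero S_eq by (metis rangeI)

  have "K u \<subseteq> G u" for u
  proof
    fix p assume p: "p \<in> K u"
    have "0 \<le> Re (cnj (a u $ i) * (conj_transpose (fst p) *v snd p) $ i)" for i
    proof -
      have "- a u $ i \<in> S"
        using symmetric S_eq by (auto simp: a_def)
      then obtain k where "s $ k = - a u $ i"
        using S_eq by auto
      then show ?thesis
        using p s_nz
        by (intro tight_imp_Re_nonneg [OF distinct_symbols, of "a u" u]) (auto simp: a_def K_def)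
    qed
    then show "p \<in> G u" by (simp add: G_def)
  qed

  have card_S: "card S = CARD('k)"
    using S_eq distinct_symbols by (simp add: card_image)
  have prob_x_nth: "prob ((\<lambda>\<omega>. x \<omega> $ i) -` {s $ k} \<inter> space P) = 1 / CARD('k)" for i k
  proof -
    have "(\<lambda>\<omega>. x \<omega> $ i) \<in> measurable P (count_space S)"
      using x_indep unfolding indep_vars_def by blast
    then have "prob ((\<lambda>\<omega>. x \<omega> $ i) -` {s $ k} \<inter> space P) =
        measure (distr P (count_space S) (\<lambda>\<omega>. x \<omega> $ i)) {s $ k}"
      using S_eq by (subst measure_distr) auto
    also have "\<dots> = 1 / CARD('k)"
      unfolding x_uniform [rule_format]
      by (subst measure_uniform_count_measure) (auto simp: S_eq card_S [unfolded S_eq])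
    finally show ?thesis .
  qed
  have prob_x: "prob (x -` {a u} \<inter> space P) = (1 / CARD('k)) ^ CARD('n)" for u
  proof -
    have "x -` {a u} \<inter> space P = (\<Inter>i\<in>UNIV. (\<lambda>\<omega>. x \<omega> $ i) -` {s $ u i} \<inter> space P)"
      by (auto simp: a_def vec_eq_iff)
    also have "prob \<dots> = (\<Prod>i\<in>UNIV. prob ((\<lambda>\<omega>. x \<omega> $ i) -` {s $ u i} \<inter> space P))"
      using S_eq by (intro indep_varsD_finite [OF x_indep]) auto
    finally show ?thesis by (simp add: prob_x_nth)
  qed

  \<comment> \<open>For almost every channel and noise, half of the symbols pass the sign condition
    at each coordinate, so the number of passing selections is the same constant.\<close>
  have AE_count: "AE p in R. (\<Sum>u\<in>UNIV. indicator (G u) p) = (CARD('k) / 2 :: real) ^ CARD('n)"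
  proof -
    have "AE p in R. \<forall>i k. Re (cnj (s $ k) * (conj_transpose (fst p) *v snd p) $ i) \<noteq> 0"
      unfolding R_def using s_nz
      by (intro AE_all_countable [THEN iffD2] allI AE_Re_conj_transpose_nonzero)
         (auto intro: H_continuous v_continuous prob_space_distr)
    then show ?thesis
    proof eventually_elim
      case (elim p)
      let ?A = "\<lambda>i. {k. 0 \<le> Re (cnj (s $ k) * (conj_transpose (fst p) *v snd p) $ i)}"
      have half: "real (card (?A i)) = CARD('k) / 2" for i
        using card_sign_half [OF distinct_symbols, of "(conj_transpose (fst p) *v snd p) $ i"]
          elim symmetric S_eq by simp
      have "(\<Sum>u\<in>UNIV. indicator (G u) p) = real (card {u. p \<in> G u})"
        by (simp add: indicator_def sum.If_cases)
      \<comment> \<open>Each condition involves one coordinate of the selection, so the passing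
        selections form a product set.\<close>
      also have "{u. p \<in> G u} = PiE UNIV ?A"
        by (auto simp: G_def a_def PiE_def)
      also have "real (card \<dots>) = (CARD('k) / 2) ^ CARD('n)"
        unfolding card_PiE [OF finite] of_nat_prod half by simp
      finally show ?case .
    qed
  qed

  \<comment> \<open>Integrating the almost surely constant count gives the sum of the probabilities;
    the single terms may depend on \<open>u\<close>.\<close>
  have "(\<Sum>u\<in>UNIV. R.prob (G u)) = (\<integral>p. (\<Sum>u\<in>UNIV. indicator (G u) p) \<partial>R)"
    using G_sets sets_R by (subst Bochner_Integration.integral_sum) (auto simp: R.emeasure_eq_measure)
  also have "\<dots> = (\<integral>p. (CARD('k) / 2) ^ CARD('n) \<partial>R)"
    using AE_count G_sets sets_R by (intro integral_cong_AE) auto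
  finally have sum_G: "(\<Sum>u\<in>UNIV. R.prob (G u)) = (CARD('k) / 2) ^ CARD('n)"
    by (simp add: R.prob_space)

  \<comment> \<open>Splitting by the value of \<open>x\<close> writes the tightness event as a
    finite union, which yields both its measurability and the bound.\<close>
  let ?T = "\<lambda>u. {\<omega> \<in> space P. x \<omega> \<in> {a u} \<and> (H \<omega>, v \<omega>) \<in> K u}"
  have T: "{\<omega> \<in> space P. esdr1t_tight s (H \<omega>) (r \<omega>) (x \<omega>)} = (\<Union>u\<in>UNIV. ?T u)"
  proof -
    have "\<exists>u. x \<omega> = a u" if "\<omega> \<in> space P" for \<omega>
    proof -
      have "\<forall>i. \<exists>k. x \<omega> $ i = s $ k"
        using x_in_S S_eq that by auto
      then show ?thesis
        by (auto simp: a_def vec_eq_iff dest: choice)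
    qed
    then show ?thesis
      using r_eq by (auto simp: K_def) metis
  qed
  have T_sets: "?T u \<in> sets P" for u
    using K_sets [of u] by measurable
  have "prob (\<Union>u\<in>UNIV. ?T u) \<le> (\<Sum>u\<in>UNIV. prob (?T u))"
    using T_sets by (intro finite_measure_subadditive_finite) auto
  also have "\<dots> = (\<Sum>u\<in>UNIV. (1 / CARD('k)) ^ CARD('n) * R.prob (K u))"
    by (intro sum.cong refl, subst indep_vars3_prob_pair [OF \<open>prob_space P\<close> mutually_indep _ K_sets])
       (simp_all add: prob_x R_def)
  also have "\<dots> \<le> (\<Sum>u\<in>UNIV. (1 / CARD('k)) ^ CARD('n) * R.prob (G u))"
    using \<open>\<And>u. K u \<subseteq> G u\<close> G_sets sets_R
    by (intro sum_mono mult_left_mono R.finite_measure_mono) auto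
  \<comment> \<open>With M symbols, each selection weighs \<open>(1 / M)^n\<close> and the sum over
    the \<open>G u\<close> is \<open>(M / 2)^n\<close>, so M cancels.\<close>
  also have "\<dots> = (1 / 2) ^ CARD('n)"
    by (simp add: sum_distrib_left [symmetric] sum_G power_mult_distrib [symmetric])
  finally show ?thesis
    unfolding T using T_sets by auto
qed

end
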